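(* Let $N_s\ge3$, $N\ge1$, $t>0$ and $U=0$, and consider the $N$-particle ground state of the Bose-Hubbard Hamiltonian on the periodic ring of $N_s$ sites, $$|\psi_0\rangle=\frac1{\sqrt{N!}}\big(\hat b_0^\dagger\big)^N|0\rangle,\qquad \hat b_0^\dagger=\frac1{\sqrt{N_s}}\sum_{j=1}^{N_s}\hat b_j^\dagger .$$ Let $\Lambda=A\sqcup B$ be a bipartition of the sites with $|A|=\ell$, $1\le\ell\le N_s-1$, and put $p=\ell/N_s$, $q=1-p$. Then $|\psi_0\rangle$ has the Schmidt decomposition $$|\psi_0\rangle=\sum_{n=0}^{N}\sqrt{\binom Nn p^nq^{N-n}}\;|n\rangle_A|N-n\rangle_B ,$$ and hence $$S_A=-\sum_{n=0}^N\binom Nn p^nq^{N-n}\ln\Big[\binom Nn p^nq^{N-n}\Big]=H(\mathrm{Bin}(N,p)),$$ which depends on $A$ only through $|A|$. In particular, if $N_s$ is even and $N=N_s$, the entropies of $\{1,\dots,N_s/2\}$ and of $\{1,3,\dots,N_s-1\}$ both equal $H(\mathrm{Bin}(N_s,\tfrac12))$.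
   Context: The sites are $\Lambda=\{1,\dots,N_s\}$, with indices modulo $N_s$. $\hat b_i,\hat b_i^\dagger$ are bosonic annihilation/creation operators and $|0\rangle$ is the vacuum. At $U=0$ the Hamiltonian is $\mathcal{H}=-t\sum_{i=1}^{N_s}(\hat b_i^\dagger\hat b_{i+1}+\mathrm{H.c.})$, restricted to the subspace of total particle number $N$. The Fock space factorizes as $\mathcal{F}=\mathcal{F}_A\otimes\mathcal{F}_B$ and $|0\rangle=|0\rangle_A|0\rangle_B$. Put $a_A^\dagger=\ell^{-1/2}\sum_{i\in A}\hat b_i^\dagger$ and $a_B^\dagger=(N_s-\ell)^{-1/2}\sum_{j\in B}\hat b_j^\dagger$. For $X\in\{A,B\}$, $|k\rangle_X=(k!)^{-1/2}(a_X^\dagger)^k|0\rangle_X$. The entanglement entropy is $S_A=-\mathrm{Tr}[\rho^A\ln\rho^A]$ with $\rho^A=\mathrm{Tr}_B|\psi_0\rangle\langle\psi_0|$. $\mathrm{Bin}(N,p)$ is the binomial distribution and $H$ denotes Shannon entropy with natural logarithm. *)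

theory Defs
  imports "HOL-Probability.Probability"
begin

text \<open>
  Sites are natural numbers.  A vector is given by its amplitudes in the orthonormal
  occupation-number basis, whose members are labelled by configurations \<open>n\<close>, with
  \<open>n i\<close> bosons on site \<open>i\<close>.  The Fock space over a set \<open>X\<close> of sites consists of the
  square-summable amplitude functions supported on the configurations that are empty
  outside \<open>X\<close>; so all the Fock spaces live in one type, and one ladder operator
  \<open>annihilate i\<close> acts on each of those with \<open>i \<in> X\<close>.
\<close>

type_synonym config = "nat \<Rightarrow> nat"
type_synonym amplitude = "config \<Rightarrow> complex"

definition configs :: "nat set \<Rightarrow> config set" where
  "configs X = {n. \<forall>i. i \<notin> X \<longrightarrow> n i = 0}"

definition fock_space :: "nat set \<Rightarrow> amplitude set" where
  "fock_space X = {\<psi>. (\<forall>n. \<psi> n \<noteq> 0 \<longrightarrow> n \<in> configs X) \<and> (\<lambda>n. (cmod (\<psi> n))\<^sup>2) summable_on UNIV}"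

definition braket :: "amplitude \<Rightarrow> amplitude \<Rightarrow> complex" where
  "braket \<phi> \<psi> = (\<Sum>\<^sub>\<infinity>n. cnj (\<phi> n) * \<psi> n)"

definition orthonormal :: "'i set \<Rightarrow> ('i \<Rightarrow> amplitude) \<Rightarrow> bool" where
  "orthonormal I e \<longleftrightarrow> (\<forall>i\<in>I. \<forall>j\<in>I. braket (e i) (e j) = (if i = j then 1 else 0))"

definition vacuum :: amplitude where
  "vacuum n = (if n = (\<lambda>_. 0) then 1 else 0)"

text \<open>
  Amplitudes of \<open>b\<^sub>i|n\<rangle> = \<surd>n\<^sub>i |n - e\<^sub>i\<rangle>\<close> and
  \<open>b\<^sub>i\<^sup>\<dagger>|n\<rangle> = \<surd>(n\<^sub>i + 1) |n + e\<^sub>i\<rangle>\<close>, extended linearly.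
\<close>

definition annihilate :: "nat \<Rightarrow> amplitude \<Rightarrow> amplitude" where
  "annihilate i \<psi> = (\<lambda>n. of_real (sqrt (real (n i + 1))) * \<psi> (n(i := n i + 1)))"

definition create :: "nat \<Rightarrow> amplitude \<Rightarrow> amplitude" where
  "create i \<psi> = (\<lambda>n. if n i = 0 then 0
                     else of_real (sqrt (real (n i))) * \<psi> (n(i := n i - 1)))"

lemma canonical_commutation:
  "annihilate i (create j \<psi>) n - create j (annihilate i \<psi>) n = (if i = j then \<psi> n else 0)"
proof (cases "i = j")
  case True
  have "complex_of_real (sqrt (real m)) * (complex_of_real (sqrt (real m)) * z) = of_nat m * z"
    for m z
    by (simp flip: mult.assoc of_real_mult)
  from this[of "n j + 1" "\<psi> n"] this[of "n j" "\<psi> n"] True show ?thesis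
    by (auto simp: annihilate_def create_def algebra_simps)
next
  case False
  then show ?thesis
    by (auto simp: annihilate_def create_def fun_upd_twist)
qed

text \<open>The ring: sites \<open>1, \<dots>, Ns\<close>, indices modulo \<open>Ns\<close>, so that the successor of \<open>Ns\<close> is \<open>1\<close>.\<close>

definition ring_succ :: "nat \<Rightarrow> nat \<Rightarrow> nat" where
  "ring_succ Ns i = i mod Ns + 1"

text \<open>The interaction is the usual \<open>(U/2) \<Sum>\<^sub>i b\<^sub>i\<^sup>\<dagger> b\<^sub>i\<^sup>\<dagger> b\<^sub>i b\<^sub>i = (U/2) \<Sum>\<^sub>i n\<^sub>i (n\<^sub>i - 1)\<close>.\<close>

definition bose_hubbard :: "nat \<Rightarrow> real \<Rightarrow> real \<Rightarrow> amplitude \<Rightarrow> amplitude" where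
  "bose_hubbard Ns t U \<psi> = (\<lambda>n.
     - of_real t * (\<Sum>i\<in>{1..Ns}. create i (annihilate (ring_succ Ns i) \<psi>) n
                                 + create (ring_succ Ns i) (annihilate i \<psi>) n)
     + of_real (U / 2) * (\<Sum>i\<in>{1..Ns}. create i (create i (annihilate i (annihilate i \<psi>))) n))"

definition particle_sector :: "nat \<Rightarrow> nat \<Rightarrow> amplitude set" where
  "particle_sector Ns N =
     {\<psi> \<in> fock_space {1..Ns}. \<forall>n. \<psi> n \<noteq> 0 \<longrightarrow> (\<Sum>i\<in>{1..Ns}. n i) = N}"

definition is_energy :: "nat \<Rightarrow> real \<Rightarrow> real \<Rightarrow> nat \<Rightarrow> amplitude \<Rightarrow> real \<Rightarrow> bool" where
  "is_energy Ns t U N \<psi> E \<longleftrightarrow>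
     \<psi> \<in> particle_sector Ns N \<and> \<psi> \<noteq> (\<lambda>_. 0) \<and>
     bose_hubbard Ns t U \<psi> = (\<lambda>n. of_real E * \<psi> n)"

definition is_ground_state :: "nat \<Rightarrow> real \<Rightarrow> real \<Rightarrow> nat \<Rightarrow> amplitude \<Rightarrow> bool" where
  "is_ground_state Ns t U N \<psi> \<longleftrightarrow>
     braket \<psi> \<psi> = 1 \<and>
     (\<exists>E. is_energy Ns t U N \<psi> E \<and> (\<forall>\<phi> E'. is_energy Ns t U N \<phi> E' \<longrightarrow> E \<le> E'))"

definition collective_create :: "nat set \<Rightarrow> amplitude \<Rightarrow> amplitude" where
  "collective_create X \<psi> = (\<lambda>n. of_real (1 / sqrt (real (card X))) * (\<Sum>i\<in>X. create i \<psi> n))"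

text \<open>The vector \<open>(k!)\<^sup>-\<^sup>1\<^sup>/\<^sup>2 (a\<^sub>X\<^sup>\<dagger>)\<^sup>k |0\<rangle>\<close>.\<close>

definition collective_number_state :: "nat set \<Rightarrow> nat \<Rightarrow> amplitude" where
  "collective_number_state X k =
     (\<lambda>n. of_real (1 / sqrt (fact k)) * (collective_create X ^^ k) vacuum n)"

definition restrict_config :: "nat set \<Rightarrow> config \<Rightarrow> config" where
  "restrict_config X n = (\<lambda>i. if i \<in> X then n i else 0)"

definition tensor :: "nat set \<Rightarrow> nat set \<Rightarrow> amplitude \<Rightarrow> amplitude \<Rightarrow> amplitude" where
  "tensor A B \<phi> \<eta> = (\<lambda>n. if n \<in> configs (A \<union> B)
                           then \<phi> (restrict_config A n) * \<eta> (restrict_config B n) else 0)"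

lemma vacuum_factorizes: "tensor A B vacuum vacuum = vacuum"
proof
  fix n
  show "tensor A B vacuum vacuum n = vacuum n"
    by (auto simp: tensor_def vacuum_def restrict_config_def configs_def fun_eq_iff split: if_splits)
qed

definition schmidt_decomposition ::
  "nat set \<Rightarrow> nat set \<Rightarrow> amplitude \<Rightarrow> 'i set \<Rightarrow> ('i \<Rightarrow> real) \<Rightarrow> ('i \<Rightarrow> amplitude) \<Rightarrow> ('i \<Rightarrow> amplitude) \<Rightarrow> bool"
where
  "schmidt_decomposition A B \<psi> I s u v \<longleftrightarrow>
     finite I \<and> (\<forall>i\<in>I. 0 \<le> s i) \<and>
     u ` I \<subseteq> fock_space A \<and> orthonormal I u \<and>
     v ` I \<subseteq> fock_space B \<and> orthonormal I v \<and>
     \<psi> = (\<lambda>n. \<Sum>i\<in>I. of_real (s i) * tensor A B (u i) (v i) n)"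

text \<open>Operators such as density matrices are given by their matrix elements \<open>\<langle>n|\<rho>|n'\<rangle>\<close>.\<close>

type_synonym kernel = "config \<Rightarrow> config \<Rightarrow> complex"

definition ket_bra :: "amplitude \<Rightarrow> amplitude \<Rightarrow> kernel" where
  "ket_bra \<phi> \<eta> = (\<lambda>n n'. \<phi> n * cnj (\<eta> n'))"

definition fock_trace :: "nat set \<Rightarrow> kernel \<Rightarrow> complex" where
  "fock_trace X \<rho> = (\<Sum>\<^sub>\<infinity>n\<in>configs X. \<rho> n n)"

text \<open>
  Trace over \<open>B\<close> of an operator on the Fock space over \<open>A \<union> B\<close>, for disjoint \<open>A\<close> and \<open>B\<close>.
  The basis vector \<open>|a\<rangle>\<^sub>A|b\<rangle>\<^sub>B\<close> is labelled by the configuration \<open>a + b\<close>.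
\<close>

definition partial_trace :: "nat set \<Rightarrow> nat set \<Rightarrow> kernel \<Rightarrow> kernel" where
  "partial_trace A B \<rho> = (\<lambda>a a'.
     if a \<in> configs A \<and> a' \<in> configs A
     then (\<Sum>\<^sub>\<infinity>b\<in>configs B. \<rho> (\<lambda>i. a i + b i) (\<lambda>i. a' i + b i)) else 0)"

definition spectral_decomposition ::
  "nat set \<Rightarrow> kernel \<Rightarrow> nat \<Rightarrow> (nat \<Rightarrow> real) \<Rightarrow> (nat \<Rightarrow> amplitude) \<Rightarrow> bool" where
  "spectral_decomposition X \<rho> m w e \<longleftrightarrow>
     e ` {..<m} \<subseteq> fock_space X \<and> orthonormal {..<m} e \<and>
     \<rho> = (\<lambda>n n'. \<Sum>k<m. of_real (w k) * ket_bra (e k) (e k) n n')"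

text \<open>
  The operator \<open>\<rho> ln \<rho>\<close> for a finite-rank density matrix \<open>\<rho>\<close>, by functional calculus with
  \<open>0 ln 0 = 0\<close> (the value of \<open>0 * ln 0\<close> in HOL).  It does not depend on the spectral
  decomposition, and the orthogonal complement of the \<open>e k\<close>, on which \<open>\<rho>\<close> vanishes, does not
  contribute.  Reduced density matrices of vectors with boundedly many particles on finitely
  many sites have finite rank.
\<close>

definition x_ln_x :: "nat set \<Rightarrow> kernel \<Rightarrow> kernel" where
  "x_ln_x X \<rho> = (THE \<sigma>. \<exists>m w e. spectral_decomposition X \<rho> m w e \<and>
     \<sigma> = (\<lambda>n n'. \<Sum>k<m. of_real (w k * ln (w k)) * ket_bra (e k) (e k) n n'))"

definition von_neumann_entropy :: "nat set \<Rightarrow> kernel \<Rightarrow> real" where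
  "von_neumann_entropy X \<rho> = - Re (fock_trace X (x_ln_x X \<rho>))"

definition entanglement_entropy :: "nat set \<Rightarrow> nat set \<Rightarrow> amplitude \<Rightarrow> real" where
  "entanglement_entropy A B \<psi> = von_neumann_entropy A (partial_trace A B (ket_bra \<psi> \<psi>))"

definition shannon_entropy :: "'a pmf \<Rightarrow> real" where
  "shannon_entropy P = prob_space.entropy (measure_pmf P) (exp 1) (count_space UNIV) (\<lambda>x. x)"

end

theory Submission
  imports Defs
begin

text \<open>
  Multiplying amplitudes by \<open>sqrt (\<Prod>i. n\<^sub>i!)\<close> turns the hopping Hamiltonian into \<open>-t\<close> times the jump
  operator of \<open>N\<close> independent random walkers on the ring, with total jump rate \<open>2N\<close>.  On the finite
  \<open>N\<close>-particle sector the maximum principle then gives \<open>E \<ge> -2tN\<close>, with equality only for constant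
  rescaled amplitudes, that is, for multiples of \<open>\<psi>\<^sub>0\<close>.  The Schmidt decomposition can be read off
  from the explicit amplitudes \<open>sqrt (k! / (|X|\<^sup>k \<Prod>i. n\<^sub>i!))\<close> of \<open>|k\<rangle>\<^sub>X\<close>, and it makes the reduced density
  matrix diagonal in the \<open>|n\<rangle>\<^sub>A\<close> with binomial weights.  That \<open>\<rho> ln \<rho>\<close> is well defined follows
  because eigenvectors of two spectral decompositions of \<open>\<rho>\<close> can overlap only when their eigenvalues agree.
\<close>

section \<open>Collective number states\<close>

definition sector :: "nat set \<Rightarrow> nat \<Rightarrow> config set" where
  "sector X k = {n \<in> configs X. sum n X = k}"

lemma finite_sector:
  assumes "finite X"
  shows "finite (sector X k)"
proof (rule finite_subset)
  \<comment> \<open>Members of the extensional function space are \<open>undefined\<close> off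
    \<open>X\<close>, whereas configurations are 0 there; the map resets these values.\<close>
  show "sector X k \<subseteq> (\<lambda>f i. if i \<in> X then f i else 0) ` (X \<rightarrow>\<^sub>E {..k})"
  proof
    fix n assume n: "n \<in> sector X k"
    have "n i \<le> k" if "i \<in> X" for i
      using member_le_sum[of i X n] that assms n by (auto simp: sector_def)
    moreover have "n = (\<lambda>i. if i \<in> X then restrict n X i else 0)"
      using n by (auto simp: sector_def configs_def)
    ultimately show "n \<in> (\<lambda>f i. if i \<in> X then f i else 0) ` (X \<rightarrow>\<^sub>E {..k})"
      by (intro image_eqI[of _ _ "restrict n X"]) auto
  qed
  show "finite ((\<lambda>f i. if i \<in> X then f i else 0) ` (X \<rightarrow>\<^sub>E {..k}))"
    using assms by (intro finite_imageI finite_PiE) auto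
qed

text \<open>Written with additions on both sides so that truncated subtraction of naturals does not
  enter.\<close>

lemma sum_fun_upd:
  fixes n :: config
  assumes "finite X" "i \<in> X"
  shows "sum (n(i := a)) X + n i = sum n X + a"
  using assms by (simp add: sum.remove[of X i])

lemma fun_upd_Suc_in_sector:
  assumes "finite X" "i \<in> X"
  shows "n(i := Suc (n i)) \<in> sector X (Suc k) \<longleftrightarrow> n \<in> sector X k"
  using sum_fun_upd[OF assms, of n "Suc (n i)"] assms by (auto simp: sector_def configs_def)

lemma fun_upd_pred_in_sector:
  assumes "finite X" "i \<in> X" "n i > 0"
  shows "n(i := n i - 1) \<in> sector X k \<longleftrightarrow> n \<in> sector X (Suc k)"
  using fun_upd_Suc_in_sector[OF assms(1,2), of "n(i := n i - 1)" k] assms(3) by simp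

text \<open>For a configuration in \<open>sector X k\<close>, \<open>fact k / weight X n\<close> is
  the multinomial coefficient of its occupations.\<close>

definition weight :: "nat set \<Rightarrow> config \<Rightarrow> real" where
  "weight X n = (\<Prod>i\<in>X. fact (n i))"

lemma weight_pos: "weight X n > 0"
  by (auto simp: weight_def intro!: prod_pos)

lemma weight_fun_upd_Suc:
  assumes "finite X" "i \<in> X"
  shows "weight X (n(i := Suc (n i))) = real (Suc (n i)) * weight X n"
  using assms by (simp add: weight_def prod.remove[of X i] algebra_simps)

lemma weight_fun_upd_pred:
  assumes "finite X" "i \<in> X" "n i > 0"
  shows "weight X n = real (n i) * weight X (n(i := n i - 1))"
  using weight_fun_upd_Suc[OF assms(1,2), of "n(i := n i - 1)"] assms(3) by simp

text \<open>Double counting of the pairs \<open>(n, i)\<close> with \<open>n i > 0\<close>, each weighted by \<open>n i\<close>.\<close>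

lemma sum_inverse_weight_sector:
  assumes "finite X"
  shows "(\<Sum>n\<in>sector X k. 1 / weight X n) = real (card X) ^ k / fact k"
proof (induction k)
  case 0
  have "sector X 0 = {\<lambda>_. 0}"
    using assms by (auto simp: sector_def configs_def fun_eq_iff)
  then show ?case by (simp add: weight_def)
next
  case (Suc k)
  \<comment> \<open>Taking one particle away from site \<open>i\<close> is a bijection from the
    configurations with \<open>i\<close> occupied onto the sector with one particle fewer, and the
    factor \<open>n i\<close> cancels against the factorial.\<close>
  have 1: "(\<Sum>n\<in>sector X (Suc k). real (n i) / weight X n) = (\<Sum>n\<in>sector X k. 1 / weight X n)"
    if i: "i \<in> X" for i
  proof -
    have "(\<Sum>n\<in>sector X (Suc k). real (n i) / weight X n) =
          (\<Sum>n\<in>{n\<in>sector X (Suc k). n i > 0}. real (n i) / weight X n)"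
      by (rule sum.mono_neutral_right) (auto simp: finite_sector assms)
    also have "\<dots> = (\<Sum>n\<in>sector X k. 1 / weight X n)"
    proof (rule sum.reindex_bij_witness[where j = "\<lambda>n. n(i := n i - 1)" and i = "\<lambda>n. n(i := Suc (n i))"],
        goal_cases)
      case (5 n)
      with weight_fun_upd_pred[OF assms i, of n] weight_pos[of X n] show ?case
        by (auto simp: field_simps)
    qed (use assms i in \<open>auto simp: fun_upd_Suc_in_sector fun_upd_pred_in_sector[simplified]\<close>)
    finally show ?thesis .
  qed
  have "real (Suc k) * (\<Sum>n\<in>sector X (Suc k). 1 / weight X n)
      = (\<Sum>n\<in>sector X (Suc k). real (sum n X) / weight X n)"
    by (auto simp: sector_def sum_distrib_left intro!: sum.cong)
  also have "\<dots> = (\<Sum>n\<in>sector X (Suc k). \<Sum>i\<in>X. real (n i) / weight X n)"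
    by (simp add: sum_divide_distrib)
  also have "\<dots> = (\<Sum>i\<in>X. \<Sum>n\<in>sector X (Suc k). real (n i) / weight X n)"
    by (rule sum.swap)
  also have "\<dots> = real (card X) * (real (card X) ^ k / fact k)"
    by (simp add: 1 Suc)
  finally show ?case
    by (simp add: field_simps del: of_nat_Suc)
qed

text \<open>Each creation operator contributes \<open>sqrt (n i)\<close>, which the change of weight
  completes to \<open>n i\<close>; summing over the sites gives the particle number, and these
  numbers multiply up to \<open>fact k\<close>.\<close>

lemma collective_create_power_vacuum:
  assumes "finite X"
  shows "(collective_create X ^^ k) vacuum n =
    (if n \<in> sector X k then of_real (fact k / (sqrt (weight X n) * sqrt (real (card X)) ^ k)) else 0)"
proof (induction k arbitrary: n)
  case 0
  have "n \<in> sector X 0 \<longleftrightarrow> n = (\<lambda>_. 0)"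
    using assms by (auto simp: sector_def configs_def fun_eq_iff)
  then show ?case by (simp add: weight_def vacuum_def)
next
  case (Suc k)
  let ?c = "fact k / sqrt (real (card X)) ^ k"
  have 1: "create i ((collective_create X ^^ k) vacuum) n =
      (if n \<in> sector X (Suc k) then of_real (real (n i) * ?c / sqrt (weight X n)) else 0)"
    if i: "i \<in> X" for i
  proof (cases "n i = 0")
    case False
    define m where "m = n(i := n i - 1)"
    have m: "m \<in> sector X k \<longleftrightarrow> n \<in> sector X (Suc k)" "weight X n = real (n i) * weight X m"
      using False fun_upd_pred_in_sector[OF assms i, of n k] weight_fun_upd_pred[OF assms i, of n]
      by (simp_all add: m_def)
    have "create i ((collective_create X ^^ k) vacuum) n =
        of_real (sqrt (real (n i))) * (collective_create X ^^ k) vacuum m"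
      using False by (simp add: create_def m_def)
    \<comment> \<open>Naming the square root \<open>r\<close> exposes the cancellation: the weight
      of \<open>n\<close> contains one more factor \<open>r * r\<close> than that of
      \<open>m\<close>.\<close>
    moreover obtain r where "r > 0" "sqrt (real (n i)) = r" "real (n i) = r * r"
      using False real_sqrt_mult_self[of "real (n i)"] by (metis abs_of_nat of_nat_0_less_iff neq0_conv real_sqrt_gt_zero)
    ultimately show ?thesis
      by (simp add: Suc m real_sqrt_mult flip: of_real_mult of_real_divide)
  qed (simp add: create_def)
  have "(\<Sum>i\<in>X. create i ((collective_create X ^^ k) vacuum) n) =
      (if n \<in> sector X (Suc k) then of_real (real (sum n X) * ?c / sqrt (weight X n)) else 0)"
    by (simp add: 1 sum_distrib_right sum_divide_distrib)
  then have "(collective_create X ^^ Suc k) vacuum n =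
      of_real (1 / sqrt (real (card X))) *
      (if n \<in> sector X (Suc k) then of_real (real (sum n X) * ?c / sqrt (weight X n)) else 0)"
    unfolding funpow.simps comp_def collective_create_def[of X "(collective_create X ^^ k) vacuum"]
    by (simp only:)
  \<comment> \<open>On the sector \<open>sum n X\<close> equals \<open>Suc k\<close>, which raises
    \<open>fact k\<close> to the next factorial.\<close>
  then show ?case
    by (simp add: sector_def field_simps del: of_nat_sum)
qed

text \<open>For nonempty \<open>X\<close> the squared amplitudes are the probabilities of the
  uniform multinomial distribution on \<open>X\<close>, so norms and Schmidt coefficients reduce to
  multinomial identities.\<close>

lemma collective_number_state_eq:
  assumes "finite X"
  shows "collective_number_state X k n =
    (if n \<in> sector X k then of_real (sqrt (fact k / (weight X n * real (card X) ^ k))) else 0)"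
proof -
  have "1 / sqrt (fact k) * (fact k / z) = fact k / sqrt (fact k) / z" for z
    by simp
  then have "1 / sqrt (fact k) * (fact k / z) = sqrt (fact k) / z" for z
    by (simp only: real_div_sqrt[OF fact_ge_zero])
  then show ?thesis
    unfolding collective_number_state_def collective_create_power_vacuum[OF assms]
    by (simp only: if_distrib[of "(*) _"] mult_zero_right of_real_mult[symmetric]
        real_sqrt_divide real_sqrt_mult real_sqrt_power)
qed

section \<open>Finite support and orthonormality\<close>

lemma infsum_supported_on_finite:
  fixes f :: "'a \<Rightarrow> 'b::{comm_monoid_add, t2_space}"
  assumes "finite S" "S \<subseteq> T" "\<And>n. n \<in> T - S \<Longrightarrow> f n = 0"
  shows "infsum f T = sum f S"
proof -
  have "infsum f T = infsum f S"
    by (rule infsum_cong_neutral) (use assms in auto)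
  then show ?thesis using assms by simp
qed

lemma sector_supported_in_fock_space:
  assumes "finite X" "\<And>n. \<psi> n \<noteq> 0 \<Longrightarrow> n \<in> sector X k"
  shows "\<psi> \<in> fock_space X"
proof -
  have "(\<lambda>n. (cmod (\<psi> n))\<^sup>2) summable_on UNIV \<longleftrightarrow> (\<lambda>n. (cmod (\<psi> n))\<^sup>2) summable_on sector X k"
    by (rule summable_on_cong_neutral) (use assms in auto)
  then show ?thesis
    using assms finite_sector[OF assms(1)] by (auto simp: fock_space_def sector_def)
qed

lemma collective_number_state_in_fock_space:
  "finite X \<Longrightarrow> collective_number_state X k \<in> fock_space X"
  by (rule sector_supported_in_fock_space) (auto simp: collective_number_state_eq split: if_splits)

text \<open>Normalisation is the multinomial identity \<open>sum_inverse_weight_sector\<close>;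
  states with different particle numbers have disjoint supports.\<close>

lemma braket_collective_number_state:
  assumes "finite X" "X \<noteq> {}"
  shows "braket (collective_number_state X j) (collective_number_state X k) = (if j = k then 1 else 0)"
proof (cases "j = k")
  case True
  have "braket (collective_number_state X k) (collective_number_state X k)
      = (\<Sum>n\<in>sector X k. of_real (fact k / (weight X n * real (card X) ^ k)))"
    unfolding braket_def
    by (subst infsum_supported_on_finite[of "sector X k"])
       (use weight_pos[of X] in \<open>auto simp: finite_sector assms collective_number_state_eq less_imp_le
          intro!: sum.cong simp flip: of_real_mult\<close>)
  also have "\<dots> = of_real (fact k / real (card X) ^ k * (\<Sum>n\<in>sector X k. 1 / weight X n))"
    by (simp add: sum_distrib_left mult.commute)
  also have "\<dots> = 1"
    using assms by (simp add: sum_inverse_weight_sector)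
  finally show ?thesis using True by simp
next
  case False
  then have "cnj (collective_number_state X j n) * collective_number_state X k n = 0" for n
    by (auto simp: collective_number_state_eq assms sector_def)
  then show ?thesis using False unfolding braket_def by (simp only: infsum_0) simp
qed

text \<open>The relabelling \<open>f\<close> serves the states on \<open>B\<close>, which are
  indexed by \<open>N - n\<close>.\<close>

lemma orthonormal_collective_number_state:
  assumes "finite X" "X \<noteq> {}" "inj_on f I"
  shows "orthonormal I (\<lambda>i. collective_number_state X (f i))"
  using assms by (auto simp: orthonormal_def braket_collective_number_state inj_on_eq_iff)

text \<open>Placing \<open>N\<close> particles uniformly on \<open>A \<union> B\<close> amounts to a
  binomial choice of how many go to \<open>A\<close>, followed by uniform placement within each
  part. The amplitudes are square roots of these probabilities and factorize in the same
  way.\<close>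

lemma collective_number_state_schmidt:
  assumes AB: "finite A" "finite B" "A \<inter> B = {}" "A \<noteq> {}" "B \<noteq> {}"
    and p: "p = real (card A) / real (card (A \<union> B))" and q: "q = 1 - p"
  shows "schmidt_decomposition A B (collective_number_state (A \<union> B) N) {0..N}
    (\<lambda>n. sqrt (real (N choose n) * p ^ n * q ^ (N - n)))
    (\<lambda>n. collective_number_state A n) (\<lambda>n. collective_number_state B (N - n))"
proof -
  define a b where "a = real (card A)" and "b = real (card B)"
  have ab: "a > 0" "b > 0"
    using AB by (auto simp: a_def b_def card_gt_0_iff)
  have cardAB: "real (card (A \<union> B)) = a + b"
    using AB by (simp add: a_def b_def card_Un_disjoint)
  have p': "p = a / (a + b)" and q': "q = b / (a + b)"
    using ab unfolding q p cardAB by (simp_all add: a_def[symmetric] field_simps)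
  have pq: "p \<ge> 0" "q \<ge> 0"
    using ab by (auto simp: p' q')
  have "(\<Sum>n=0..N. of_real (sqrt (real (N choose n) * p ^ n * q ^ (N - n))) *
          tensor A B (collective_number_state A n) (collective_number_state B (N - n)) c)
      = collective_number_state (A \<union> B) N c" (is "(\<Sum>n=0..N. ?f n) = ?r") for c
  proof (cases "c \<in> sector (A \<union> B) N")
    case False
    \<comment> \<open>A nonzero term would put \<open>n\<close> particles into \<open>A\<close> and
      \<open>N - n\<close> into \<open>B\<close>, hence \<open>N\<close> in total.\<close>
    have "?f n = 0" if "n \<in> {0..N}" for n
    proof (rule ccontr)
      assume "?f n \<noteq> 0"
      then have "c \<in> configs (A \<union> B)" "restrict_config A c \<in> sector A n"
        "restrict_config B c \<in> sector B (N - n)"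
        using AB by (auto simp: tensor_def collective_number_state_eq split: if_splits)
      moreover have "sum c (A \<union> B) = sum (restrict_config A c) A + sum (restrict_config B c) B"
        using AB by (simp add: sum.union_disjoint restrict_config_def)
      ultimately show False
        using False that by (auto simp: sector_def)
    qed
    then have "(\<Sum>n=0..N. ?f n) = 0"
      by (rule sum.neutral[OF ballI])
    then show ?thesis
      using False AB by (simp add: collective_number_state_eq)
  next
    case True
    \<comment> \<open>The number of particles of \<open>c\<close> in \<open>A\<close> singles out
      the only term of the sum that survives.\<close>
    define k where "k = sum c A"
    have sumB: "sum c B = N - k" and kN: "k \<le> N"
      using True AB by (auto simp: sector_def sum.union_disjoint k_def)
    have rA: "restrict_config A c \<in> sector A n \<longleftrightarrow> n = k" for n
      by (auto simp: sector_def configs_def restrict_config_def k_def)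
    have rB: "restrict_config B c \<in> sector B (N - k)"
      by (auto simp: sector_def configs_def restrict_config_def sumB)
    have W: "weight A (restrict_config A c) = weight A c" "weight B (restrict_config B c) = weight B c"
      "weight (A \<union> B) c = weight A c * weight B c"
      using AB by (auto simp: weight_def restrict_config_def prod.union_disjoint)
    have "(\<Sum>n=0..N. ?f n) = ?f k"
    proof -
      have "(\<Sum>n=0..N. ?f n) = (\<Sum>n\<in>{k}. ?f n)"
        using kN by (intro sum.mono_neutral_right)
          (auto simp: tensor_def collective_number_state_eq AB rA)
      then show ?thesis by simp
    qed
    also have "\<dots> = of_real (sqrt ((real (N choose k) * p ^ k * q ^ (N - k)) *
        (fact k / (weight A c * a ^ k)) * (fact (N - k) / (weight B c * b ^ (N - k)))))"
      using True rA rB by (simp add: tensor_def collective_number_state_eq AB W sector_def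
          a_def b_def mult.assoc flip: of_real_mult real_sqrt_mult)
    also have "(real (N choose k) * p ^ k * q ^ (N - k)) *
        (fact k / (weight A c * a ^ k)) * (fact (N - k) / (weight B c * b ^ (N - k)))
      = fact N / (weight (A \<union> B) c * (a + b) ^ N)"
    proof -
      have "(a + b) ^ N = (a + b) ^ k * (a + b) ^ (N - k)"
        using kN by (simp flip: power_add)
      then show ?thesis
        using ab weight_pos[of A c] weight_pos[of B c]
        by (simp add: binomial_fact[OF kN] p' q' W power_divide field_simps)
    qed
    also have "of_real (sqrt (fact N / (weight (A \<union> B) c * (a + b) ^ N))) = ?r"
      using True AB by (simp add: collective_number_state_eq cardAB)
    finally show ?thesis .
  qed
  then show ?thesis
    unfolding schmidt_decomposition_def using AB pq
    by (auto simp: collective_number_state_in_fock_space fun_eq_iff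
        intro!: orthonormal_collective_number_state[of A "\<lambda>i. i"] orthonormal_collective_number_state inj_onI)
qed

section \<open>Entropy of a vector with a finite Schmidt decomposition\<close>

lemma has_sum_finite_sum:
  fixes f :: "'i \<Rightarrow> 'a \<Rightarrow> 'b::topological_comm_monoid_add"
  assumes "\<And>i. i \<in> I \<Longrightarrow> (f i has_sum s i) A"
  shows "((\<lambda>x. \<Sum>i\<in>I. f i x) has_sum (\<Sum>i\<in>I. s i)) A"
  using assms by (induction I rule: infinite_finite_induct) (auto intro: has_sum_add)

text \<open>Absolute convergence follows by comparison with the sum of the two squared
  moduli.\<close>

lemma has_sum_braket:
  assumes "\<phi> \<in> fock_space X" "\<psi> \<in> fock_space X"
  shows "((\<lambda>n. cnj (\<phi> n) * \<psi> n) has_sum braket \<phi> \<psi>) UNIV"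
proof -
  have "(\<lambda>n. (cmod (\<phi> n))\<^sup>2 + (cmod (\<psi> n))\<^sup>2) summable_on UNIV"
    using assms by (intro summable_on_add) (auto simp: fock_space_def)
  moreover have "cmod (cnj (\<phi> n) * \<psi> n) \<le> (cmod (\<phi> n))\<^sup>2 + (cmod (\<psi> n))\<^sup>2" for n
  proof -
    have "2 * (cmod (\<phi> n) * cmod (\<psi> n)) \<le> (cmod (\<phi> n))\<^sup>2 + (cmod (\<psi> n))\<^sup>2"
      using sum_squares_bound[of "cmod (\<phi> n)" "cmod (\<psi> n)"] by simp
    moreover have "0 \<le> cmod (\<phi> n) * cmod (\<psi> n)" by simp
    ultimately show ?thesis unfolding norm_mult complex_mod_cnj by linarith
  qed
  ultimately have "(\<lambda>n. cmod (cnj (\<phi> n) * \<psi> n)) summable_on UNIV"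
    by (rule Infinite_Sum.abs_summable_on_comparison_test')
  then show ?thesis
    unfolding braket_def by (rule has_sum_infsum[OF abs_summable_summable])
qed

lemma braket_sum_right:
  assumes "\<phi> \<in> fock_space X" "\<And>i. i \<in> I \<Longrightarrow> e i \<in> fock_space X"
  shows "braket \<phi> (\<lambda>n. \<Sum>i\<in>I. c i * e i n) = (\<Sum>i\<in>I. c i * braket \<phi> (e i))"
proof -
  have "((\<lambda>n. \<Sum>i\<in>I. c i * (cnj (\<phi> n) * e i n)) has_sum (\<Sum>i\<in>I. c i * braket \<phi> (e i))) UNIV"
    by (intro has_sum_finite_sum has_sum_cmult_right has_sum_braket[of _ X] assms)
  then show ?thesis
    by (auto simp: braket_def[of \<phi> "\<lambda>n. \<Sum>i\<in>I. c i * e i n"] sum_distrib_left algebra_simps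
        dest: infsumI)
qed

lemma cnj_braket: "cnj (braket \<phi> \<psi>) = braket \<psi> \<phi>"
  using infsum_cnj[of "\<lambda>n. cnj (\<phi> n) * \<psi> n" UNIV] by (simp add: braket_def mult.commute del: infsum_cnj)

section \<open>Independence of the functional calculus from the spectral decomposition\<close>

lemma spectral_decomposition_apply:
  assumes "spectral_decomposition X \<rho> m w e" "\<psi> \<in> fock_space X"
  shows "(\<Sum>\<^sub>\<infinity>n'. \<rho> n n' * \<psi> n') = (\<Sum>k<m. of_real (w k) * braket (e k) \<psi> * e k n)"
proof -
  have e: "e k \<in> fock_space X" if "k < m" for k
    using assms(1) that by (auto simp: spectral_decomposition_def)
  have "((\<lambda>n'. \<Sum>k<m. of_real (w k) * e k n * (cnj (e k n') * \<psi> n')) has_sum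
      (\<Sum>k<m. of_real (w k) * e k n * braket (e k) \<psi>)) UNIV"
    by (intro has_sum_finite_sum has_sum_cmult_right has_sum_braket[of _ X] assms e) auto
  then have "(\<Sum>\<^sub>\<infinity>n'. \<Sum>k<m. of_real (w k) * e k n * (cnj (e k n') * \<psi> n')) =
      (\<Sum>k<m. of_real (w k) * e k n * braket (e k) \<psi>)"
    by (rule infsumI)
  moreover have "\<rho> n n' * \<psi> n' = (\<Sum>k<m. of_real (w k) * e k n * (cnj (e k n') * \<psi> n'))" for n'
  proof -
    have "\<rho> n n' = (\<Sum>k<m. of_real (w k) * ket_bra (e k) (e k) n n')"
      using assms(1) by (simp add: spectral_decomposition_def)
    then show ?thesis
      by (simp add: ket_bra_def sum_distrib_right mult.assoc)
  qed
  ultimately show ?thesis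
    by (simp add: mult.assoc mult.left_commute mult.commute)
qed

text \<open>Applying \<open>\<rho>\<close> to \<open>f j\<close> through either decomposition gives
  the first claim. Pairing it with \<open>e k\<close> gives
  \<open>w' j * braket (e k) (f j) = w k * braket (e k) (f j)\<close>, hence the second.\<close>

lemma spectral_decomposition_overlap:
  assumes e: "spectral_decomposition X \<rho> m w e" and f: "spectral_decomposition X \<rho> m' w' f"
  assumes j: "j < m'"
  shows "of_real (w' j) * f j n = (\<Sum>k<m. of_real (w k) * braket (e k) (f j) * e k n)"
    and "k < m \<Longrightarrow> braket (e k) (f j) \<noteq> 0 \<Longrightarrow> w k = w' j"
proof -
  have E: "e k \<in> fock_space X" if "k < m" for k
    using e that by (auto simp: spectral_decomposition_def)
  have F: "f k \<in> fock_space X" if "k < m'" for k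
    using f that by (auto simp: spectral_decomposition_def)
  have *: "of_real (w' j) * f j n = (\<Sum>k<m. of_real (w k) * braket (e k) (f j) * e k n)" for n
  proof -
    have "(\<Sum>k<m. of_real (w k) * braket (e k) (f j) * e k n) =
        (\<Sum>k<m'. of_real (w' k) * braket (f k) (f j) * f k n)"
      using spectral_decomposition_apply[OF e F[OF j]] spectral_decomposition_apply[OF f F[OF j]]
      by simp
    also have "\<dots> = (\<Sum>k<m'. if k = j then of_real (w' j) * f j n else 0)"
      using f j by (intro sum.cong) (auto simp: spectral_decomposition_def orthonormal_def)
    finally show ?thesis
      using j by simp
  qed
  show "of_real (w' j) * f j n = (\<Sum>k<m. of_real (w k) * braket (e k) (f j) * e k n)"
    by (rule *)
  assume k: "k < m" and ne: "braket (e k) (f j) \<noteq> 0"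
  have "of_real (w' j) * braket (e k) (f j) = braket (e k) (\<lambda>n. \<Sum>i\<in>{j}. of_real (w' j) * f i n)"
    using braket_sum_right[OF E[OF k], of "{j}" f "\<lambda>_. of_real (w' j)"] F[OF j] by simp
  also have "(\<lambda>n. \<Sum>i\<in>{j}. of_real (w' j) * f i n) = (\<lambda>n. \<Sum>k<m. of_real (w k) * braket (e k) (f j) * e k n)"
    using * by simp
  also have "braket (e k) \<dots> = (\<Sum>i<m. of_real (w i) * braket (e i) (f j) * braket (e k) (e i))"
    by (rule braket_sum_right[OF E[OF k]]) (use E in auto)
  also have "\<dots> = (\<Sum>i<m. if i = k then of_real (w k) * braket (e k) (f j) else 0)"
    using e k by (intro sum.cong) (auto simp: spectral_decomposition_def orthonormal_def)
  finally show "w k = w' j"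
    using k ne by simp
qed

text \<open>Since overlaps vanish unless the eigenvalues agree, \<open>h\<close> may be applied to
  the coefficients in the expansion of \<open>\<rho>\<close> acting on \<open>f j\<close>.\<close>

lemma functional_calculus_expand:
  fixes h :: "real \<Rightarrow> real"
  assumes e: "spectral_decomposition X \<rho> m w e" and f: "spectral_decomposition X \<rho> m' w' f"
    and j: "j < m'" and h: "h 0 = 0"
  shows "of_real (h (w' j)) * f j n = (\<Sum>k<m. of_real (h (w k)) * braket (e k) (f j) * e k n)"
proof -
  have h_eq: "of_real (h (w k)) * braket (e k) (f j) = of_real (h (w' j)) * braket (e k) (f j)"
    if "k < m" for k
    using spectral_decomposition_overlap(2)[OF e f j that] by (cases "braket (e k) (f j) = 0") auto
  have w_eq: "of_real (w k) * braket (e k) (f j) = of_real (w' j) * braket (e k) (f j)"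
    if "k < m" for k
    using spectral_decomposition_overlap(2)[OF e f j that] by (cases "braket (e k) (f j) = 0") auto
  have "of_real (h (w' j)) * f j n = of_real (h (w' j)) * (\<Sum>k<m. braket (e k) (f j) * e k n)"
  proof (cases "w' j = 0")
    \<comment> \<open>For a nonzero eigenvalue, division shows that \<open>f j\<close> lies in the
      span of the \<open>e k\<close>. For eigenvalue 0 it may leave that span, and
      \<open>h 0 = 0\<close> makes both sides vanish.\<close>
    case False
    have "of_real (w' j) * f j n = of_real (w' j) * (\<Sum>k<m. braket (e k) (f j) * e k n)"
      using w_eq by (auto simp: spectral_decomposition_overlap(1)[OF e f j] sum_distrib_left mult.assoc[symmetric]
          intro!: sum.cong)
    then show ?thesis using False by simp
  qed (simp add: h)
  also have "\<dots> = (\<Sum>k<m. of_real (h (w k)) * braket (e k) (f j) * e k n)"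
    unfolding sum_distrib_left mult.assoc[symmetric] by (intro sum.cong refl) (simp add: h_eq)
  finally show ?thesis .
qed

text \<open>The vectors \<open>f j\<close> are expanded in the \<open>e k\<close>, the sums are
  swapped, and the expansion with the two decompositions exchanged collapses the inner sum.\<close>

lemma functional_calculus_unique:
  fixes h :: "real \<Rightarrow> real"
  assumes e: "spectral_decomposition X \<rho> m w e" and f: "spectral_decomposition X \<rho> m' w' f"
    and h: "h 0 = 0"
  shows "(\<Sum>j<m'. of_real (h (w' j)) * ket_bra (f j) (f j) n n') =
         (\<Sum>k<m. of_real (h (w k)) * ket_bra (e k) (e k) n n')"
proof -
  have "(\<Sum>j<m'. of_real (h (w' j)) * ket_bra (f j) (f j) n n') =
      (\<Sum>j<m'. \<Sum>k<m. of_real (h (w k)) * braket (e k) (f j) * e k n * cnj (f j n'))"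
    using functional_calculus_expand[where h = h and n = n, OF e f _ h]
    by (simp add: ket_bra_def sum_distrib_right mult.assoc[symmetric])
  also have "\<dots> = (\<Sum>k<m. \<Sum>j<m'. of_real (h (w k)) * braket (e k) (f j) * e k n * cnj (f j n'))"
    by (rule sum.swap)
  also have "\<dots> = (\<Sum>k<m. of_real (h (w k)) * ket_bra (e k) (e k) n n')"
  proof (rule sum.cong[OF refl])
    fix k assume k: "k \<in> {..<m}"
    \<comment> \<open>Trading \<open>h (w k)\<close> for \<open>h (w' j)\<close> on every overlap
      produces the coefficients of the expansion of \<open>e k\<close> in the
      \<open>f j\<close>.\<close>
    have "of_real (h (w k)) * braket (e k) (f j) = of_real (h (w' j)) * braket (e k) (f j)"
      if "j < m'" for j
      using spectral_decomposition_overlap(2)[OF e f that, of k] k by (cases "braket (e k) (f j) = 0") auto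
    then have "(\<Sum>j<m'. of_real (h (w k)) * braket (e k) (f j) * e k n * cnj (f j n')) =
        e k n * cnj (\<Sum>j<m'. of_real (h (w' j)) * braket (f j) (e k) * f j n')"
      by (auto simp: sum_distrib_left cnj_braket algebra_simps intro!: sum.cong)
    also have "\<dots> = e k n * cnj (of_real (h (w k)) * e k n')"
      using functional_calculus_expand[where h = h and j = k and n = n', OF f e _ h] k by simp
    finally show "(\<Sum>j<m'. of_real (h (w k)) * braket (e k) (f j) * e k n * cnj (f j n')) =
        of_real (h (w k)) * ket_bra (e k) (e k) n n'"
      by (simp add: ket_bra_def)
  qed
  finally show ?thesis .
qed

text \<open>The definite description is justified by uniqueness of the functional calculus for
  \<open>x * ln x\<close>, whose value at 0 is 0.\<close>

lemma x_ln_x_spectral: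
  assumes "spectral_decomposition X \<rho> m w e"
  shows "x_ln_x X \<rho> = (\<lambda>n n'. \<Sum>k<m. of_real (w k * ln (w k)) * ket_bra (e k) (e k) n n')"
  unfolding x_ln_x_def
proof (rule the_equality)
  fix \<sigma> assume "\<exists>m w e. spectral_decomposition X \<rho> m w e \<and>
     \<sigma> = (\<lambda>n n'. \<Sum>k<m. of_real (w k * ln (w k)) * ket_bra (e k) (e k) n n')"
  then show "\<sigma> = (\<lambda>n n'. \<Sum>k<m. of_real (w k * ln (w k)) * ket_bra (e k) (e k) n n')"
    using functional_calculus_unique[OF assms, of _ _ _ "\<lambda>x. x * ln x"] by (auto simp: fun_eq_iff)
qed (use assms in auto)

lemma von_neumann_entropy_spectral:
  assumes "spectral_decomposition X \<rho> m w e"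
  shows "von_neumann_entropy X \<rho> = - (\<Sum>k<m. w k * ln (w k))"
proof -
  have e: "e k \<in> fock_space X" "braket (e k) (e k) = 1" if "k < m" for k
    using assms that by (auto simp: spectral_decomposition_def orthonormal_def)
  have "((\<lambda>n. \<Sum>k<m. of_real (w k * ln (w k)) * (cnj (e k n) * e k n)) has_sum
      (\<Sum>k<m. of_real (w k * ln (w k)) * braket (e k) (e k))) UNIV"
    by (intro has_sum_finite_sum has_sum_cmult_right has_sum_braket[of _ X] e) auto
  then have "(\<Sum>\<^sub>\<infinity>n. \<Sum>k<m. of_real (w k * ln (w k)) * (cnj (e k n) * e k n)) =
      (\<Sum>k<m. of_real (w k * ln (w k)) * braket (e k) (e k))"
    by (rule infsumI)
  moreover have "fock_trace X (x_ln_x X \<rho>) =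
      (\<Sum>\<^sub>\<infinity>n. \<Sum>k<m. of_real (w k * ln (w k)) * (cnj (e k n) * e k n))"
    unfolding fock_trace_def x_ln_x_spectral[OF assms]
  \<comment> \<open>The trace may run over all configurations because the \<open>e k\<close> vanish
    outside \<open>configs X\<close>; each projector then contributes its norm 1.\<close>
  proof (rule infsum_cong_neutral)
    fix n assume "n \<in> UNIV - configs X"
    then have "e k n = 0" if "k < m" for k
      using e(1)[OF that] by (auto simp: fock_space_def)
    then show "(\<Sum>k<m. of_real (w k * ln (w k)) * (cnj (e k n) * e k n)) = 0"
      by simp
  qed (auto simp: ket_bra_def mult.commute)
  ultimately have "fock_trace X (x_ln_x X \<rho>) = of_real (\<Sum>k<m. w k * ln (w k))"
    by (simp add: e)
  then show ?thesis
    by (simp add: von_neumann_entropy_def)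
qed

text \<open>Summing over the configurations of \<open>B\<close> turns products of the
  \<open>v\<close> into inner products, so orthonormality removes every cross term and leaves the
  squares of the Schmidt coefficients.\<close>

lemma spectral_decomposition_partial_trace:
  assumes AB: "A \<inter> B = {}" and \<psi>: "schmidt_decomposition A B \<psi> {..<m} s u v"
  shows "spectral_decomposition A (partial_trace A B (ket_bra \<psi> \<psi>)) m (\<lambda>k. (s k)\<^sup>2) u"
proof -
  have u: "u k \<in> fock_space A" and v: "v k \<in> fock_space B" if "k < m" for k
    using \<psi> that by (auto simp: schmidt_decomposition_def)
  have ortho: "braket (v j) (v i) = (if i = j then 1 else 0)" if "i < m" "j < m" for i j
    using \<psi> that by (auto simp: schmidt_decomposition_def orthonormal_def)
  have "partial_trace A B (ket_bra \<psi> \<psi>) a a' = (\<Sum>k<m. of_real ((s k)\<^sup>2) * ket_bra (u k) (u k) a a')"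
    for a a'
  proof (cases "a \<in> configs A \<and> a' \<in> configs A")
    case True
    \<comment> \<open>As \<open>A\<close> and \<open>B\<close> are disjoint, the two summands can be
      recovered from \<open>c + b\<close> by restriction.\<close>
    have val: "\<psi> (\<lambda>i. c i + b i) = (\<Sum>k<m. of_real (s k) * u k c * v k b)"
      if "c \<in> configs A" "b \<in> configs B" for c b
    proof -
      have "restrict_config A (\<lambda>i. c i + b i) = c" "restrict_config B (\<lambda>i. c i + b i) = b"
        "(\<lambda>i. c i + b i) \<in> configs (A \<union> B)"
        using that AB by (auto simp: restrict_config_def configs_def fun_eq_iff)
      then show ?thesis
        using \<psi> by (simp add: schmidt_decomposition_def tensor_def mult.assoc)
    qed
    let ?T = "\<lambda>b. \<Sum>i<m. \<Sum>j<m. of_real (s i) * u i a * of_real (s j) * cnj (u j a') * (cnj (v j b) * v i b)"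
    have "(?T has_sum (\<Sum>i<m. \<Sum>j<m. of_real (s i) * u i a * of_real (s j) * cnj (u j a') * braket (v j) (v i))) UNIV"
      by (intro has_sum_finite_sum has_sum_cmult_right has_sum_braket[of _ B] v) auto
    then have "infsum ?T UNIV =
        (\<Sum>i<m. \<Sum>j<m. of_real (s i) * u i a * of_real (s j) * cnj (u j a') * braket (v j) (v i))"
      by (rule infsumI)
    also have "\<dots> = (\<Sum>i<m. \<Sum>j<m. if i = j then of_real ((s i)\<^sup>2) * ket_bra (u i) (u i) a a' else 0)"
      by (intro sum.cong refl) (auto simp: ortho ket_bra_def power2_eq_square)
    also have "\<dots> = (\<Sum>i<m. of_real ((s i)\<^sup>2) * ket_bra (u i) (u i) a a')"
      by simp
    finally have "infsum ?T UNIV = (\<Sum>i<m. of_real ((s i)\<^sup>2) * ket_bra (u i) (u i) a a')" .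
    moreover have "partial_trace A B (ket_bra \<psi> \<psi>) a a' = infsum ?T UNIV"
      unfolding partial_trace_def ket_bra_def if_P[OF True]
    proof (rule infsum_cong_neutral)
      fix b assume "b \<in> UNIV - configs B"
      then have "v k b = 0" if "k < m" for k
        using v[OF that] by (auto simp: fock_space_def)
      then show "?T b = 0" by simp
    next
      fix b assume "b \<in> configs B \<inter> UNIV"
      then show "\<psi> (\<lambda>i. a i + b i) * cnj (\<psi> (\<lambda>i. a' i + b i)) = ?T b"
        using True by (simp add: val sum_product algebra_simps)
    qed auto
    ultimately show ?thesis by simp
  next
    case False
    have "ket_bra (u k) (u k) a a' = 0" if "k < m" for k
      using u[OF that] False by (auto simp: ket_bra_def fock_space_def)
    then have "(\<Sum>k<m. of_real ((s k)\<^sup>2) * ket_bra (u k) (u k) a a') = 0"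
      by simp
    moreover have "partial_trace A B (ket_bra \<psi> \<psi>) a a' = 0"
      using False by (auto simp: partial_trace_def)
    ultimately show ?thesis by simp
  qed
  then show ?thesis
    using \<psi> by (auto simp: spectral_decomposition_def schmidt_decomposition_def fun_eq_iff)
qed

lemma entanglement_entropy_schmidt:
  fixes s :: "nat \<Rightarrow> real"
  assumes "A \<inter> B = {}" "schmidt_decomposition A B \<psi> {..<m} s u v"
  shows "entanglement_entropy A B \<psi> = - (\<Sum>k<m. (s k)\<^sup>2 * ln ((s k)\<^sup>2))"
  unfolding entanglement_entropy_def
  using von_neumann_entropy_spectral[where w = "\<lambda>k. (s k)\<^sup>2", OF spectral_decomposition_partial_trace, OF assms] .

section \<open>Shannon entropy of a finitely supported distribution\<close>

lemma shannon_entropy_finite_support: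
  fixes P :: "'a::countable pmf"
  assumes "finite S" "set_pmf P \<subseteq> S"
  shows "shannon_entropy P = - (\<Sum>x\<in>S. pmf P x * ln (pmf P x))"
proof -
  interpret P: information_space "measure_pmf P" "exp 1"
    by unfold_locales auto
  \<comment> \<open>The target measure of \<open>distr\<close> supplies only the space and the
    measurable sets, so the law of the identity is \<open>P\<close> itself, with counting density
    \<open>pmf P\<close>.\<close>
  have "distr (measure_pmf P) (count_space UNIV) (\<lambda>x. x) = distr (measure_pmf P) (measure_pmf P) (\<lambda>x. x)"
    by (rule distr_cong) auto
  then have "distr (measure_pmf P) (count_space UNIV) (\<lambda>x. x) = density (count_space UNIV) (pmf P)"
    by (simp add: distr_id2 flip: measure_pmf_eq_density)
  then have "distributed (measure_pmf P) (count_space UNIV) (\<lambda>x. x) (pmf P)"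
    by (simp add: distributed_def)
  then have "shannon_entropy P = - (\<integral>x. pmf P x * log (exp 1) (pmf P x) \<partial>count_space UNIV)"
    unfolding shannon_entropy_def by (rule P.entropy_distr) simp
  also have "(\<integral>x. pmf P x * log (exp 1) (pmf P x) \<partial>count_space UNIV) =
      (\<Sum>x | x \<in> UNIV \<and> pmf P x * log (exp 1) (pmf P x) \<noteq> 0. pmf P x * log (exp 1) (pmf P x))"
    by (rule lebesgue_integral_count_space_finite_support)
       (rule finite_subset[OF _ assms(1)], use assms(2) in \<open>auto simp: set_pmf_eq\<close>)
  also have "\<dots> = (\<Sum>x\<in>S. pmf P x * ln (pmf P x))"
    using assms by (intro sum.mono_neutral_cong_left) (auto simp: set_pmf_eq log_def)
  finally show ?thesis .
qed

section \<open>The ground state on the ring\<close>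

text \<open>If \<open>n i = 0\<close>, the subtraction truncates and a particle is gained; such
  jumps enter the Hamiltonian with coefficient \<open>n i\<close>, hence not at all.\<close>

definition hop :: "nat \<Rightarrow> nat \<Rightarrow> config \<Rightarrow> config" where
  "hop i j n = n(i := n i - 1, j := n j + 1)"

lemma hop_in_sector:
  assumes "finite X" "i \<in> X" "j \<in> X" "i \<noteq> j" "n i > 0"
  shows "hop i j n \<in> sector X k \<longleftrightarrow> n \<in> sector X k"
proof (cases k)
  case 0
  \<comment> \<open>With no particles both memberships fail: site \<open>i\<close> is occupied
    before the hop and site \<open>j\<close> after it.\<close>
  have "0 < n i" "0 < hop i j n j"
    using assms by (simp_all add: hop_def)
  then have "sum n X \<noteq> 0" "sum (hop i j n) X \<noteq> 0"
    using assms by (metis sum_eq_0_iff less_numeral_extra(3))+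
  then show ?thesis
    by (simp add: sector_def 0)
next
  case (Suc k')
  have "hop i j n \<in> sector X (Suc k') \<longleftrightarrow> n(i := n i - 1) \<in> sector X k'"
    using fun_upd_Suc_in_sector[OF assms(1,3), of "n(i := n i - 1)" k'] assms(4)
    by (simp only: hop_def fun_upd_other Suc_eq_plus1)
  also have "\<dots> \<longleftrightarrow> n \<in> sector X (Suc k')"
    by (rule fun_upd_pred_in_sector[of X i n k', OF assms(1,2,5)])
  finally show ?thesis
    by (simp add: Suc)
qed

text \<open>
  Multiplication by \<open>sqrt (weight X n)\<close> turns the hopping amplitudes into the jump rates \<open>n i\<close>
  of independent random walkers.
\<close>

definition rescale :: "nat set \<Rightarrow> amplitude \<Rightarrow> amplitude" where
  "rescale X \<psi> n = of_real (sqrt (weight X n)) * \<psi> n"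

text \<open>The weight of the hopped configuration absorbs the annihilation factor, while
  \<open>sqrt (n i)\<close> occurs twice. The operator moves a particle from \<open>j\<close> to
  \<open>i\<close>, so its amplitude at \<open>n\<close> is read off with that particle moved
  back.\<close>

lemma rescale_create_annihilate:
  assumes "finite X" "i \<in> X" "j \<in> X" "i \<noteq> j"
  shows "of_real (sqrt (weight X n)) * create i (annihilate j \<psi>) n =
    of_nat (n i) * rescale X \<psi> (hop i j n)"
proof (cases "n i = 0")
  case False
  define m where "m = n(i := n i - 1)"
  have h: "hop i j n = m(j := Suc (m j))" and mj: "m j = n j"
    using assms by (auto simp: hop_def m_def)
  have w: "weight X n = real (n i) * weight X m"
    using weight_fun_upd_pred[OF assms(1,2), of n] False by (simp add: m_def)
  have w': "weight X (hop i j n) = real (Suc (m j)) * weight X m"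
    unfolding h by (rule weight_fun_upd_Suc[OF assms(1,3)])
  have "create i (annihilate j \<psi>) n =
      of_real (sqrt (real (n i))) * (of_real (sqrt (real (Suc (m j)))) * \<psi> (hop i j n))"
    using False unfolding h by (simp add: create_def annihilate_def m_def)
  then have "of_real (sqrt (weight X n)) * create i (annihilate j \<psi>) n =
      of_real (sqrt (real (n i)) * sqrt (real (n i))) * (of_real (sqrt (weight X (hop i j n))) * \<psi> (hop i j n))"
    unfolding w w' by (simp add: real_sqrt_mult del: of_nat_Suc real_sqrt_mult_self)
  then show ?thesis
    by (simp add: rescale_def)
qed (simp add: create_def)

section \<open>The cyclic successor and the rescaled Hamiltonian\<close>

lemma ring_succ_eq: "i \<in> {1..Ns} \<Longrightarrow> ring_succ Ns i = (if i = Ns then 1 else Suc i)"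
  by (simp add: ring_succ_def)

lemma ring_succ_in: "i \<in> {1..Ns} \<Longrightarrow> ring_succ Ns i \<in> {1..Ns}"
  by (auto simp: ring_succ_eq)

lemma ring_succ_neq: "Ns \<ge> 2 \<Longrightarrow> i \<in> {1..Ns} \<Longrightarrow> ring_succ Ns i \<noteq> i"
  by (auto simp: ring_succ_eq)

lemma sum_ring_succ: "(\<Sum>i\<in>{1..Ns}. f (ring_succ Ns i)) = (\<Sum>i\<in>{1..Ns}. f i)"
proof -
  have "inj_on (ring_succ Ns) {1..Ns}"
  proof (rule inj_onI)
    fix i j assume "i \<in> {1..Ns}" "j \<in> {1..Ns}" "ring_succ Ns i = ring_succ Ns j"
    then show "i = j"
      by (cases "i = Ns"; cases "j = Ns") (simp_all add: ring_succ_eq)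
  qed
  moreover have "ring_succ Ns ` {1..Ns} \<subseteq> {1..Ns}"
    using ring_succ_in by blast
  ultimately have "bij_betw (ring_succ Ns) {1..Ns} {1..Ns}"
    unfolding bij_betw_def by (metis endo_inj_surj finite_atLeastAtMost)
  then show ?thesis
    by (rule sum.reindex_bij_betw)
qed

lemma rescale_bose_hubbard:
  assumes "Ns \<ge> 2"
  shows "rescale {1..Ns} (bose_hubbard Ns t 0 \<psi>) n = - of_real t * (\<Sum>i\<in>{1..Ns}.
     of_nat (n i) * rescale {1..Ns} \<psi> (hop i (ring_succ Ns i) n) +
     of_nat (n (ring_succ Ns i)) * rescale {1..Ns} \<psi> (hop (ring_succ Ns i) i n))"
proof -
  let ?w = "complex_of_real (sqrt (weight {1..Ns} n))"
  have "rescale {1..Ns} (bose_hubbard Ns t 0 \<psi>) n = - of_real t * (\<Sum>i\<in>{1..Ns}.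
     ?w * create i (annihilate (ring_succ Ns i) \<psi>) n + ?w * create (ring_succ Ns i) (annihilate i \<psi>) n)"
    by (simp add: rescale_def bose_hubbard_def mult.left_commute flip: distrib_left sum_distrib_left)
  also have "(\<Sum>i\<in>{1..Ns}. ?w * create i (annihilate (ring_succ Ns i) \<psi>) n +
      ?w * create (ring_succ Ns i) (annihilate i \<psi>) n) = (\<Sum>i\<in>{1..Ns}.
     of_nat (n i) * rescale {1..Ns} \<psi> (hop i (ring_succ Ns i) n) +
     of_nat (n (ring_succ Ns i)) * rescale {1..Ns} \<psi> (hop (ring_succ Ns i) i n))"
  proof (rule sum.cong[OF refl])
    fix i assume "i \<in> {1..Ns}"
    moreover from this have "ring_succ Ns i \<in> {1..Ns}" "ring_succ Ns i \<noteq> i"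
      using ring_succ_in ring_succ_neq assms by auto
    ultimately show "?w * create i (annihilate (ring_succ Ns i) \<psi>) n +
        ?w * create (ring_succ Ns i) (annihilate i \<psi>) n =
      of_nat (n i) * rescale {1..Ns} \<psi> (hop i (ring_succ Ns i) n) +
      of_nat (n (ring_succ Ns i)) * rescale {1..Ns} \<psi> (hop (ring_succ Ns i) i n)"
      using rescale_create_annihilate[of "{1..Ns}"] by (metis finite_atLeastAtMost)
  qed
  finally show ?thesis .
qed

text \<open>This is the total jump rate: each particle may leave its site in either
  direction.\<close>

lemma sum_occupations_both_ends:
  assumes "n \<in> sector {1..Ns} N"
  shows "(\<Sum>i\<in>{1..Ns}. n i + n (ring_succ Ns i)) = 2 * N"
  using assms sum_ring_succ[of n Ns] by (simp add: sector_def sum.distrib)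

lemma particle_sector_iff:
  "\<psi> \<in> particle_sector Ns N \<longleftrightarrow> (\<forall>n. \<psi> n \<noteq> 0 \<longrightarrow> n \<in> sector {1..Ns} N)"
proof
  assume "\<forall>n. \<psi> n \<noteq> 0 \<longrightarrow> n \<in> sector {1..Ns} N"
  moreover from this have "\<psi> \<in> fock_space {1..Ns}"
    by (intro sector_supported_in_fock_space[where k = N]) auto
  ultimately show "\<psi> \<in> particle_sector Ns N"
    by (auto simp: particle_sector_def sector_def)
qed (auto simp: particle_sector_def sector_def fock_space_def)

text \<open>
  At a maximum of \<open>g\<close> every jump with positive rate leads to another maximum; moving all particles
  to site \<open>Ns\<close> along \<open>i \<rightarrow> i + 1\<close> shows that the maximum is attained there.
\<close>

lemma harmonic_le_all_on_last_site:
  fixes g :: "config \<Rightarrow> real"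
  assumes Ns: "Ns \<ge> 2"
    and harm: "\<And>n. n \<in> sector {1..Ns} N \<Longrightarrow> (\<Sum>i\<in>{1..Ns}.
      real (n i) * (g n - g (hop i (ring_succ Ns i) n)) +
      real (n (ring_succ Ns i)) * (g n - g (hop (ring_succ Ns i) i n))) = 0"
    and n: "n \<in> sector {1..Ns} N"
  shows "g n \<le> g ((\<lambda>_. 0)(Ns := N))"
proof -
  let ?S = "sector {1..Ns} N"
  define M where "M = Max (g ` ?S)"
  have le: "g n \<le> M" if "n \<in> ?S" for n
    using that by (simp add: M_def finite_sector)
  have "M \<in> g ` ?S"
    unfolding M_def using n by (intro Max_in) (auto simp: finite_sector)
  then obtain m where "m \<in> ?S" "g m = M" by auto
  then have "g ((\<lambda>_. 0)(Ns := N)) = M"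
  \<comment> \<open>The measure adds up the distances of the particles from site \<open>Ns\<close>;
    a jump from \<open>i\<close> to \<open>Suc i\<close> with \<open>i < Ns\<close> lowers it by
    one.\<close>
  proof (induction "\<Sum>i\<in>{1..Ns}. m i * (Ns - i)" arbitrary: m rule: less_induct)
    case less
    show ?case
    proof (cases "\<exists>i\<in>{1..<Ns}. m i > 0")
      case False
      then have 0: "m i = 0" if "i \<noteq> Ns" for i
        using less.prems(1) that by (cases "i \<in> {1..Ns}") (auto simp: sector_def configs_def)
      have "sum m {1..Ns} = (\<Sum>i\<in>{Ns}. m i)"
        using Ns 0 by (intro sum.mono_neutral_right) auto
      with 0 have "m = (\<lambda>_. 0)(Ns := N)"
        using less.prems(1) by (auto simp: sector_def fun_eq_iff)
      then show ?thesis using less.prems(2) by simp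
    next
      case True
      then obtain i where i: "1 \<le> i" "i < Ns" "m i > 0" by auto
      let ?h = "hop i (ring_succ Ns i) m"
      \<comment> \<open>At a maximum all summands of the harmonicity condition are nonnegative, so
        their vanishing sum forces each of them to be 0.\<close>
      have pos: "real (m i) * (g m - g (hop i j m)) \<ge> 0"
        if "i \<in> {1..Ns}" "j \<in> {1..Ns}" "i \<noteq> j" for i j
        using that hop_in_sector[of "{1..Ns}" i j m N] less.prems le[of "hop i j m"]
        by (cases "m i = 0") auto
      have pos1: "real (m i) * (g m - g (hop i (ring_succ Ns i) m)) \<ge> 0"
        and pos2: "real (m (ring_succ Ns i)) * (g m - g (hop (ring_succ Ns i) i m)) \<ge> 0"
        if "i \<in> {1..Ns}" for i
        using that Ns ring_succ_in[of i Ns] ring_succ_neq[of Ns i]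
          pos[of i "ring_succ Ns i"] pos[of "ring_succ Ns i" i] by auto
      have "real (m i) * (g m - g ?h) + real (m (ring_succ Ns i)) * (g m - g (hop (ring_succ Ns i) i m)) = 0"
        using harm[OF less.prems(1)] i pos1 pos2
        by (subst (asm) sum_nonneg_eq_0_iff) (auto intro: add_nonneg_nonneg)
      with pos1[of i] pos2[of i] i have g: "g ?h = M"
        using less.prems(2) by (auto simp: add_nonneg_eq_0_iff)
      have S: "?h \<in> ?S"
        using hop_in_sector[of "{1..Ns}" i "Suc i" m N] less.prems(1) i by (simp add: ring_succ_eq)
      have "(\<Sum>k\<in>{1..Ns}. ?h k * (Ns - k)) < (\<Sum>k\<in>{1..Ns}. m k * (Ns - k))"
      proof -
        have "(\<Sum>k\<in>{1..Ns}. f k) = f i + f (Suc i) + (\<Sum>k\<in>{1..Ns} - {i, Suc i}. f k)" for f :: "nat \<Rightarrow> nat"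
          using i by (subst sum.subset_diff[of "{i, Suc i}"]) auto
        note split = this
        have "(\<Sum>k\<in>{1..Ns} - {i, Suc i}. ?h k * (Ns - k)) = (\<Sum>k\<in>{1..Ns} - {i, Suc i}. m k * (Ns - k))"
          using i by (intro sum.cong) (auto simp: hop_def ring_succ_eq)
        \<comment> \<open>These two representations remove the truncated subtractions at the sites
          \<open>i\<close> and \<open>Suc i\<close>.\<close>
        moreover obtain a where "m i = Suc a"
          using i by (cases "m i") auto
        moreover obtain d where "Ns = Suc (i + d)"
          using i less_iff_Suc_add by auto
        ultimately show ?thesis
          unfolding split[of "\<lambda>k. ?h k * (Ns - k)"] split[of "\<lambda>k. m k * (Ns - k)"]
          using i by (simp add: hop_def ring_succ_eq)
      qed
      from less.hyps[OF this S g] show ?thesis .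
    qed
  qed
  with le[OF n] show ?thesis by simp
qed

text \<open>The one-sided bound applies to \<open>g\<close> and to \<open>- g\<close>, with the same
  reference configuration.\<close>

lemma harmonic_eq_on_sector:
  fixes g :: "config \<Rightarrow> real"
  assumes Ns: "Ns \<ge> 2"
    and harm: "\<And>n. n \<in> sector {1..Ns} N \<Longrightarrow> (\<Sum>i\<in>{1..Ns}.
      real (n i) * (g n - g (hop i (ring_succ Ns i) n)) +
      real (n (ring_succ Ns i)) * (g n - g (hop (ring_succ Ns i) i n))) = 0"
    and n: "n \<in> sector {1..Ns} N"
  shows "g n = g ((\<lambda>_. 0)(Ns := N))"
proof (rule antisym)
  show "g n \<le> g ((\<lambda>_. 0)(Ns := N))"
    by (rule harmonic_le_all_on_last_site[OF assms])
  have "- g n \<le> - g ((\<lambda>_. 0)(Ns := N))"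
  proof (rule harmonic_le_all_on_last_site[OF Ns _ n])
    fix n assume "n \<in> sector {1..Ns} N"
    then have "- (\<Sum>i\<in>{1..Ns}. real (n i) * (g n - g (hop i (ring_succ Ns i) n)) +
      real (n (ring_succ Ns i)) * (g n - g (hop (ring_succ Ns i) i n))) = 0"
      using harm by simp
    then show "(\<Sum>i\<in>{1..Ns}. real (n i) * (- g n - - g (hop i (ring_succ Ns i) n)) +
      real (n (ring_succ Ns i)) * (- g n - - g (hop (ring_succ Ns i) i n))) = 0"
      unfolding sum_negf[symmetric] by (simp add: algebra_simps)
  qed
  then show "g ((\<lambda>_. 0)(Ns := N)) \<le> g n" by simp
qed

section \<open>The minimal energy and its eigenvectors\<close>

lemma rescaled_eigenvalue_equation:
  assumes "Ns \<ge> 2" "is_energy Ns t 0 N \<psi> E"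
  shows "of_real E * rescale {1..Ns} \<psi> n = - of_real t * (\<Sum>i\<in>{1..Ns}.
     of_nat (n i) * rescale {1..Ns} \<psi> (hop i (ring_succ Ns i) n) +
     of_nat (n (ring_succ Ns i)) * rescale {1..Ns} \<psi> (hop (ring_succ Ns i) i n))"
proof -
  have "bose_hubbard Ns t 0 \<psi> = (\<lambda>n. of_real E * \<psi> n)"
    using assms(2) by (simp add: is_energy_def)
  then show ?thesis
    using rescale_bose_hubbard[OF assms(1), of t \<psi> n] by (simp add: rescale_def mult.left_commute)
qed

text \<open>A Gershgorin argument: where the rescaled amplitude has maximal modulus, the triangle
  inequality bounds \<open>\<bar>E\<bar>\<close> by \<open>t\<close> times the total jump
  rate.\<close>

lemma energy_lower_bound:
  assumes Ns: "Ns \<ge> 2" and t: "t > 0" and E: "is_energy Ns t 0 N \<psi> E"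
  shows "- 2 * t * real N \<le> E"
proof -
  let ?S = "sector {1..Ns} N" and ?F = "rescale {1..Ns} \<psi>"
  have supp: "\<psi> n \<noteq> 0 \<Longrightarrow> n \<in> ?S" for n
    using E by (auto simp: is_energy_def particle_sector_iff)
  obtain n0 where n0: "\<psi> n0 \<noteq> 0"
    using E by (auto simp: is_energy_def)
  have "Max ((\<lambda>n. cmod (?F n)) ` ?S) \<in> (\<lambda>n. cmod (?F n)) ` ?S"
    using supp[OF n0] by (intro Max_in) (auto simp: finite_sector)
  then obtain n where n: "n \<in> ?S" and max: "cmod (?F n) = Max ((\<lambda>n. cmod (?F n)) ` ?S)" by auto
  \<comment> \<open>Configurations outside the sector are included, so hops from empty sites need no
    separate treatment.\<close>
  have le: "cmod (?F m) \<le> cmod (?F n)" for m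
  proof (cases "m \<in> ?S")
    case True
    then show ?thesis
      unfolding max by (intro Max_ge) (auto simp: finite_sector)
  next
    case False
    then have "\<psi> m = 0" using supp by blast
    then show ?thesis by (simp add: rescale_def)
  qed
  have "0 < cmod (?F n0)"
    using n0 weight_pos[of "{1..Ns}" n0] by (simp add: rescale_def)
  with le[of n0] have pos: "cmod (?F n) > 0" by linarith
  have "\<bar>E\<bar> * cmod (?F n) = t * cmod (\<Sum>i\<in>{1..Ns}.
     of_nat (n i) * ?F (hop i (ring_succ Ns i) n) +
     of_nat (n (ring_succ Ns i)) * ?F (hop (ring_succ Ns i) i n))"
    using arg_cong[OF rescaled_eigenvalue_equation[OF Ns E, of n], of cmod] t
    by (simp add: norm_mult)
  also have "\<dots> \<le> t * (\<Sum>i\<in>{1..Ns}. real (n i + n (ring_succ Ns i)) * cmod (?F n))"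
  proof (intro mult_left_mono order.trans[OF norm_sum] sum_mono order.trans[OF norm_triangle_ineq])
    fix i
    show "cmod (of_nat (n i) * ?F (hop i (ring_succ Ns i) n)) +
        cmod (of_nat (n (ring_succ Ns i)) * ?F (hop (ring_succ Ns i) i n))
      \<le> real (n i + n (ring_succ Ns i)) * cmod (?F n)"
      using le by (auto simp: norm_mult distrib_right intro!: add_mono mult_left_mono)
  qed (use t in auto)
  also have "\<dots> = t * real (\<Sum>i\<in>{1..Ns}. n i + n (ring_succ Ns i)) * cmod (?F n)"
    by (simp only: sum_distrib_right of_nat_sum mult.assoc)
  also have "\<dots> = (2 * t * real N) * cmod (?F n)"
    using sum_occupations_both_ends[OF n] by simp
  finally have "\<bar>E\<bar> \<le> 2 * t * real N"
    using pos by simp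
  then show ?thesis by simp
qed

text \<open>At this energy the eigenvalue equation says that the rescaled amplitudes are harmonic
  for the walk; the maximum principle is applied to real and imaginary parts separately.\<close>

lemma energy_minimal_eq:
  assumes Ns: "Ns \<ge> 2" and t: "t > 0" and E: "is_energy Ns t 0 N \<psi> (- 2 * t * real N)"
    and n: "n \<in> sector {1..Ns} N"
  shows "rescale {1..Ns} \<psi> n = rescale {1..Ns} \<psi> ((\<lambda>_. 0)(Ns := N))"
proof -
  let ?F = "rescale {1..Ns} \<psi>"
  have harm: "(\<Sum>i\<in>{1..Ns}. of_nat (n i) * (?F n - ?F (hop i (ring_succ Ns i) n)) +
      of_nat (n (ring_succ Ns i)) * (?F n - ?F (hop (ring_succ Ns i) i n))) = 0"
    if n: "n \<in> sector {1..Ns} N" for n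
  proof -
    have "(\<Sum>i\<in>{1..Ns}. of_nat (n i) * (?F n - ?F (hop i (ring_succ Ns i) n)) +
      of_nat (n (ring_succ Ns i)) * (?F n - ?F (hop (ring_succ Ns i) i n)))
      = of_nat (\<Sum>i\<in>{1..Ns}. n i + n (ring_succ Ns i)) * ?F n -
       (\<Sum>i\<in>{1..Ns}. of_nat (n i) * ?F (hop i (ring_succ Ns i) n) +
      of_nat (n (ring_succ Ns i)) * ?F (hop (ring_succ Ns i) i n))"
      unfolding of_nat_sum sum_distrib_right sum_subtractf[symmetric]
      by (intro sum.cong) (auto simp: algebra_simps)
    moreover have "of_nat (2 * N) * ?F n =
       (\<Sum>i\<in>{1..Ns}. of_nat (n i) * ?F (hop i (ring_succ Ns i) n) +
      of_nat (n (ring_succ Ns i)) * ?F (hop (ring_succ Ns i) i n))" (is "_ = ?R")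
    proof -
      have "complex_of_real t * (of_nat (2 * N) * ?F n) = of_real t * ?R"
        using rescaled_eigenvalue_equation[OF Ns E, of n] by (simp add: algebra_simps)
      then show ?thesis using t by simp
    qed
    ultimately show ?thesis
      by (simp only: sum_occupations_both_ends[OF n] diff_self)
  qed
  have "Re (?F n) = Re (?F ((\<lambda>_. 0)(Ns := N)))"
    by (rule harmonic_eq_on_sector[OF Ns _ n]) (use arg_cong[OF harm, of _ Re] in simp)
  moreover have "Im (?F n) = Im (?F ((\<lambda>_. 0)(Ns := N)))"
    by (rule harmonic_eq_on_sector[OF Ns _ n]) (use arg_cong[OF harm, of _ Im] in simp)
  ultimately show ?thesis by (rule complex_eqI)
qed

section \<open>The collective state as the unique ground state\<close>

lemma rescale_collective_number_state:
  assumes "finite X"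
  shows "rescale X (collective_number_state X k) n =
    (if n \<in> sector X k then of_real (sqrt (fact k / real (card X) ^ k)) else 0)"
  using weight_pos[of X n]
  by (auto simp: rescale_def collective_number_state_eq[OF assms] simp flip: of_real_mult real_sqrt_mult)

lemma rescale_inject: "rescale X \<phi> n = rescale X \<psi> n \<longleftrightarrow> \<phi> n = \<psi> n"
  using weight_pos[of X n] by (simp add: rescale_def)

text \<open>The rescaled amplitudes are constant on the sector and jumps stay inside it, so hopping
  multiplies them by the total jump rate.\<close>

lemma is_energy_collective_number_state:
  assumes Ns: "Ns \<ge> 2"
  shows "is_energy Ns t 0 N (collective_number_state {1..Ns} N) (- 2 * t * real N)"
proof -
  let ?\<psi> = "collective_number_state {1..Ns} N" and ?S = "sector {1..Ns} N"
  let ?c = "complex_of_real (sqrt (fact N / real Ns ^ N))"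
  have F: "rescale {1..Ns} ?\<psi> n = (if n \<in> ?S then ?c else 0)" for n
    by (simp add: rescale_collective_number_state)
  have hop: "of_nat (n i) * rescale {1..Ns} ?\<psi> (hop i j n) = of_nat (n i) * rescale {1..Ns} ?\<psi> n"
    if "i \<in> {1..Ns}" "j \<in> {1..Ns}" "i \<noteq> j" for n i j
    using that hop_in_sector[of "{1..Ns}" i j n N] by (cases "n i = 0") (auto simp: F simp del: One_nat_def)
  have "bose_hubbard Ns t 0 ?\<psi> n = of_real (- 2 * t * real N) * ?\<psi> n" for n
  proof -
    have "rescale {1..Ns} (bose_hubbard Ns t 0 ?\<psi>) n = - of_real t * (\<Sum>i\<in>{1..Ns}.
      of_nat (n i) * rescale {1..Ns} ?\<psi> n + of_nat (n (ring_succ Ns i)) * rescale {1..Ns} ?\<psi> n)"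
      unfolding rescale_bose_hubbard[OF Ns]
    proof (intro arg_cong[where f = "(*) _"] sum.cong refl)
      fix i assume "i \<in> {1..Ns}"
      moreover from this have "ring_succ Ns i \<in> {1..Ns}" "ring_succ Ns i \<noteq> i"
        using ring_succ_in ring_succ_neq Ns by auto
      ultimately show "of_nat (n i) * rescale {1..Ns} ?\<psi> (hop i (ring_succ Ns i) n) +
          of_nat (n (ring_succ Ns i)) * rescale {1..Ns} ?\<psi> (hop (ring_succ Ns i) i n) =
        of_nat (n i) * rescale {1..Ns} ?\<psi> n + of_nat (n (ring_succ Ns i)) * rescale {1..Ns} ?\<psi> n"
        using hop[of i "ring_succ Ns i" n] hop[of "ring_succ Ns i" i n] by auto
    qed
    also have "\<dots> = - of_real t * (of_nat (\<Sum>i\<in>{1..Ns}. n i + n (ring_succ Ns i)) * rescale {1..Ns} ?\<psi> n)"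
      by (simp add: sum_distrib_right distrib_right)
    also have "\<dots> = rescale {1..Ns} (\<lambda>n. of_real (- 2 * t * real N) * ?\<psi> n) n"
    proof (cases "n \<in> ?S")
      case True
      then show ?thesis
        using sum_occupations_both_ends[OF True] by (simp add: rescale_def)
    next
      case False
      then show ?thesis by (simp add: rescale_def collective_number_state_eq)
    qed
    finally show ?thesis by (simp only: rescale_inject)
  qed
  moreover have "?\<psi> \<in> particle_sector Ns N"
    by (auto simp: particle_sector_iff collective_number_state_eq split: if_splits)
  moreover have "?\<psi> \<noteq> (\<lambda>_. 0)"
    using braket_collective_number_state[of "{1..Ns}" N N] Ns by (auto simp: braket_def)
  ultimately show ?thesis
    by (auto simp: is_energy_def)
qed

lemma is_ground_state_collective_number_state:
  assumes "Ns \<ge> 2" "t > 0"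
  shows "is_ground_state Ns t 0 N (collective_number_state {1..Ns} N)"
  using assms is_energy_collective_number_state[of Ns t N] energy_lower_bound[of Ns t N]
  by (auto simp: is_ground_state_def braket_collective_number_state)

text \<open>The lower bound is attained, so any ground state has that energy and constant rescaled
  amplitudes; normalisation then leaves only a phase.\<close>

lemma ground_state_unique:
  assumes Ns: "Ns \<ge> 2" and t: "t > 0" and \<phi>: "is_ground_state Ns t 0 N \<phi>"
  shows "\<exists>c. cmod c = 1 \<and> \<phi> = (\<lambda>n. c * collective_number_state {1..Ns} N n)"
proof -
  let ?\<psi> = "collective_number_state {1..Ns} N" and ?S = "sector {1..Ns} N"
  let ?top = "(\<lambda>_. 0)(Ns := N)"
  obtain E where E: "is_energy Ns t 0 N \<phi> E" "\<And>\<phi> E'. is_energy Ns t 0 N \<phi> E' \<Longrightarrow> E \<le> E'"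
    using \<phi> by (auto simp: is_ground_state_def)
  have "E = - 2 * t * real N"
    using energy_lower_bound[OF Ns t E(1)] E(2)[OF is_energy_collective_number_state[OF Ns, of t N]] by simp
  then have \<phi>E: "is_energy Ns t 0 N \<phi> (- 2 * t * real N)" using E(1) by simp
  \<comment> \<open>\<open>d\<close> is the constant rescaled amplitude of the collective state, and
    \<open>c\<close> the ratio of the two constants, read off with all particles on site
    \<open>Ns\<close>.\<close>
  define d where "d = complex_of_real (sqrt (fact N / real Ns ^ N))"
  define c where "c = rescale {1..Ns} \<phi> ?top / d"
  have "d \<noteq> 0" using Ns by (simp add: d_def)
  have eq: "\<phi> = (\<lambda>n. c * ?\<psi> n)"
  proof
    fix n
    show "\<phi> n = c * ?\<psi> n"
    proof (cases "n \<in> ?S")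
      case True
      have "rescale {1..Ns} \<phi> n = c * rescale {1..Ns} ?\<psi> n"
        using energy_minimal_eq[OF Ns t \<phi>E True] True \<open>d \<noteq> 0\<close>
        by (simp add: rescale_collective_number_state c_def d_def)
      also have "\<dots> = rescale {1..Ns} (\<lambda>n. c * ?\<psi> n) n"
        by (simp add: rescale_def)
      finally show ?thesis by (simp only: rescale_inject)
    next
      case False
      then show ?thesis
        using E(1) by (auto simp: is_energy_def particle_sector_iff collective_number_state_eq)
    qed
  qed
  have "braket \<phi> \<phi> = (\<Sum>\<^sub>\<infinity>n. (cnj c * c) * (cnj (?\<psi> n) * ?\<psi> n))"
    unfolding braket_def eq by (simp add: algebra_simps)
  also have "\<dots> = (cnj c * c) * braket ?\<psi> ?\<psi>"
    unfolding braket_def by (rule infsum_cmult_right')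
  also have "\<dots> = of_real ((cmod c)\<^sup>2)"
    using Ns by (simp add: braket_collective_number_state complex_norm_square mult.commute del: of_real_power)
  finally have "complex_of_real ((cmod c)\<^sup>2) = 1"
    using \<phi> by (simp add: is_ground_state_def)
  then have "(cmod c)\<^sup>2 = 1"
    by (simp only: of_real_eq_1_iff)
  then have "cmod c = 1"
    using power2_eq_1_iff[of "cmod c"] norm_ge_zero[of c] by linarith
  with eq show ?thesis by blast
qed

section \<open>Binomial entropy of the collective state\<close>

lemma entanglement_entropy_collective_number_state:
  assumes AB: "finite A" "finite B" "A \<inter> B = {}" "A \<noteq> {}" "B \<noteq> {}"
    and p: "p = real (card A) / real (card (A \<union> B))" and q: "q = 1 - p"
  shows "entanglement_entropy A B (collective_number_state (A \<union> B) N) =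
    - (\<Sum>n=0..N. real (N choose n) * p ^ n * q ^ (N - n) * ln (real (N choose n) * p ^ n * q ^ (N - n)))"
proof -
  have "card A \<le> card (A \<union> B)"
    using AB by (intro card_mono) auto
  moreover have "card (A \<union> B) > 0"
    using AB by (auto simp: card_gt_0_iff)
  ultimately have "p \<ge> 0" "q \<ge> 0"
    by (simp_all add: p q)
  then have "(sqrt (real (N choose n) * p ^ n * q ^ (N - n)))\<^sup>2 = real (N choose n) * p ^ n * q ^ (N - n)" for n
    by simp
  \<comment> \<open>Spectral decompositions are indexed by initial segments \<open>{..<m}\<close>,
    hence the change of index set.\<close>
  moreover have "{0..N} = {..<Suc N}" by auto
  ultimately show ?thesis
    using entanglement_entropy_schmidt[OF AB(3)
        collective_number_state_schmidt[OF assms, of N, unfolded \<open>{0..N} = {..<Suc N}\<close>]]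
    by (simp del: real_sqrt_pow2_iff)
qed

lemma shannon_entropy_binomial_pmf:
  assumes "p \<in> {0..1}"
  shows "shannon_entropy (binomial_pmf N p) =
    - (\<Sum>n=0..N. real (N choose n) * p ^ n * (1 - p) ^ (N - n) * ln (real (N choose n) * p ^ n * (1 - p) ^ (N - n)))"
proof -
  have "shannon_entropy (binomial_pmf N p) =
      - (\<Sum>n=0..N. pmf (binomial_pmf N p) n * ln (pmf (binomial_pmf N p) n))"
    by (rule shannon_entropy_finite_support) (use assms in \<open>auto simp: set_pmf_binomial_eq split: if_splits\<close>)
  then show ?thesis using assms by simp
qed

lemma entanglement_entropy_collective_number_state_binomial:
  assumes AB: "A \<union> B = {1..Ns}" "A \<inter> B = {}" "A \<noteq> {}" "B \<noteq> {}"
  shows "entanglement_entropy A B (collective_number_state {1..Ns} N) =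
    shannon_entropy (binomial_pmf N (real (card A) / real Ns))"
proof -
  have fin: "finite A" "finite B"
    using AB(1) finite_subset[of A "{1..Ns}"] finite_subset[of B "{1..Ns}"] by auto
  have "card A \<le> Ns"
    using AB(1) card_mono[of "{1..Ns}" A] by auto
  then have "real (card A) / real Ns \<in> {0..1}"
    by (auto intro!: divide_le_eq_1[THEN iffD2])
  then show ?thesis
    using entanglement_entropy_collective_number_state[OF fin AB(2-4) refl refl, of N]
    by (simp add: AB(1) shannon_entropy_binomial_pmf)
qed

lemma card_odd_upto: "card {i \<in> {1..2 * k}. odd i} = (k::nat)"
proof -
  have "{i \<in> {1..2 * k}. odd i} = (\<lambda>j. 2 * j + 1) ` {..<k}"
    by (auto elim!: oddE simp: image_iff)
  then show ?thesis
    by (simp add: card_image inj_on_def)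
qed

theorem mainTheorem5:
  fixes Ns N l :: nat and t U p q :: real and A B :: "nat set" and \<psi>\<^sub>0 :: amplitude
  assumes "Ns \<ge> 3" and "N \<ge> 1" and "t > 0" and "U = 0"
    and psi0: "\<psi>\<^sub>0 = (\<lambda>n. of_real (1 / sqrt (fact N)) * (collective_create {1..Ns} ^^ N) vacuum n)"
    and "A \<union> B = {1..Ns}" and "A \<inter> B = {}" and "card A = l"
    and "1 \<le> l" and "l \<le> Ns - 1"
    and "p = real l / real Ns" and "q = 1 - p"
  shows
    "(is_ground_state Ns t U N \<psi>\<^sub>0 \<and>
      (\<forall>\<phi>. is_ground_state Ns t U N \<phi> \<longrightarrow> (\<exists>c. cmod c = 1 \<and> \<phi> = (\<lambda>n. c * \<psi>\<^sub>0 n)))) \<and>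
     schmidt_decomposition A B \<psi>\<^sub>0 {0..N}
       (\<lambda>n. sqrt (real (N choose n) * p ^ n * q ^ (N - n)))
       (\<lambda>n. collective_number_state A n) (\<lambda>n. collective_number_state B (N - n)) \<and>
     entanglement_entropy A B \<psi>\<^sub>0 =
       - (\<Sum>n=0..N. real (N choose n) * p ^ n * q ^ (N - n) *
                    ln (real (N choose n) * p ^ n * q ^ (N - n))) \<and>
     entanglement_entropy A B \<psi>\<^sub>0 = shannon_entropy (binomial_pmf N p) \<and>
     (\<forall>A' B'. A' \<union> B' = {1..Ns} \<and> A' \<inter> B' = {} \<and> card A' = card A \<longrightarrow>
        entanglement_entropy A' B' \<psi>\<^sub>0 = entanglement_entropy A B \<psi>\<^sub>0) \<and>
     (even Ns \<and> N = Ns \<longrightarrow>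
        entanglement_entropy {1..Ns div 2} ({1..Ns} - {1..Ns div 2}) \<psi>\<^sub>0
          = shannon_entropy (binomial_pmf Ns (1 / 2)) \<and>
        entanglement_entropy {i \<in> {1..Ns}. odd i} ({1..Ns} - {i \<in> {1..Ns}. odd i}) \<psi>\<^sub>0
          = shannon_entropy (binomial_pmf Ns (1 / 2)))"
proof -
  have psi: "\<psi>\<^sub>0 = collective_number_state {1..Ns} N"
    by (simp add: psi0 collective_number_state_def)
  have Ns: "Ns \<ge> 2" using \<open>Ns \<ge> 3\<close> by simp
  have parts: "finite A' \<and> finite B' \<and> A' \<noteq> {} \<and> B' \<noteq> {}"
    if "A' \<union> B' = {1..Ns}" "1 \<le> card A'" "card A' \<le> Ns - 1" for A' B' :: "nat set"
  proof -
    have "B' \<noteq> {}"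
      using that Ns by auto
    moreover have "finite (A' \<union> B')"
      unfolding that by simp
    ultimately show ?thesis using that(2) by auto
  qed
  \<comment> \<open>Stated for every admissible bipartition: the right-hand side sees only
    \<open>card A'\<close>, which yields dependence on size alone and both half-ring values.\<close>
  have entropy: "entanglement_entropy A' B' \<psi>\<^sub>0 = shannon_entropy (binomial_pmf N (real (card A') / real Ns))"
    if "A' \<union> B' = {1..Ns}" "A' \<inter> B' = {}" "1 \<le> card A'" "card A' \<le> Ns - 1" for A' B' :: "nat set"
    unfolding psi using that parts[OF that(1,3,4)]
    by (intro entanglement_entropy_collective_number_state_binomial) auto
  have l: "1 \<le> card A" "card A \<le> Ns - 1"
    using \<open>card A = l\<close> \<open>1 \<le> l\<close> \<open>l \<le> Ns - 1\<close> by auto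
  note AB = parts[OF \<open>A \<union> B = {1..Ns}\<close> l]
  have p: "p = real (card A) / real (card (A \<union> B))"
    using \<open>p = real l / real Ns\<close> \<open>card A = l\<close> \<open>A \<union> B = {1..Ns}\<close> by simp
  have half: "entanglement_entropy A' ({1..Ns} - A') \<psi>\<^sub>0 = shannon_entropy (binomial_pmf Ns (1 / 2))"
    if "even Ns" "N = Ns" "A' \<subseteq> {1..Ns}" "card A' = Ns div 2" for A'
  proof -
    have "entanglement_entropy A' ({1..Ns} - A') \<psi>\<^sub>0 = shannon_entropy (binomial_pmf N (real (card A') / real Ns))"
      by (rule entropy) (use that Ns in auto)
    moreover have "real (card A') / real Ns = 1 / 2"
      using that Ns by (simp add: real_of_nat_div)
    ultimately show ?thesis using that by simp
  qed
  have "is_ground_state Ns t U N \<psi>\<^sub>0"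
    using is_ground_state_collective_number_state[OF Ns \<open>t > 0\<close>] \<open>U = 0\<close> by (simp add: psi)
  moreover have "\<exists>c. cmod c = 1 \<and> \<phi> = (\<lambda>n. c * \<psi>\<^sub>0 n)" if "is_ground_state Ns t U N \<phi>" for \<phi>
    using ground_state_unique[OF Ns \<open>t > 0\<close>, of N \<phi>] that \<open>U = 0\<close> by (simp add: psi)
  moreover have "schmidt_decomposition A B \<psi>\<^sub>0 {0..N}
       (\<lambda>n. sqrt (real (N choose n) * p ^ n * q ^ (N - n)))
       (\<lambda>n. collective_number_state A n) (\<lambda>n. collective_number_state B (N - n))"
    using collective_number_state_schmidt[of A B p q N] AB p \<open>q = 1 - p\<close> \<open>A \<inter> B = {}\<close> \<open>A \<union> B = {1..Ns}\<close>
    by (simp add: psi)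
  moreover have "entanglement_entropy A B \<psi>\<^sub>0 =
       - (\<Sum>n=0..N. real (N choose n) * p ^ n * q ^ (N - n) *
                    ln (real (N choose n) * p ^ n * q ^ (N - n)))"
    using entanglement_entropy_collective_number_state[of A B p q N]
      AB p \<open>q = 1 - p\<close> \<open>A \<inter> B = {}\<close> \<open>A \<union> B = {1..Ns}\<close>
    by (simp add: psi)
  moreover have "entanglement_entropy A B \<psi>\<^sub>0 = shannon_entropy (binomial_pmf N p)"
    using entropy[OF \<open>A \<union> B = {1..Ns}\<close> \<open>A \<inter> B = {}\<close> l] p \<open>A \<union> B = {1..Ns}\<close> by simp
  moreover have "entanglement_entropy A' B' \<psi>\<^sub>0 = entanglement_entropy A B \<psi>\<^sub>0"
    if "A' \<union> B' = {1..Ns}" "A' \<inter> B' = {}" "card A' = card A" for A' B'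
    using entropy[of A' B'] entropy[OF \<open>A \<union> B = {1..Ns}\<close> \<open>A \<inter> B = {}\<close> l] that l by simp
  moreover have "entanglement_entropy {1..Ns div 2} ({1..Ns} - {1..Ns div 2}) \<psi>\<^sub>0
          = shannon_entropy (binomial_pmf Ns (1 / 2))" if "even Ns" "N = Ns"
    using that by (rule half) auto
  moreover have "entanglement_entropy {i \<in> {1..Ns}. odd i} ({1..Ns} - {i \<in> {1..Ns}. odd i}) \<psi>\<^sub>0
          = shannon_entropy (binomial_pmf Ns (1 / 2))" if "even Ns" "N = Ns"
    using that
  proof (rule half)
    show "card {i \<in> {1..Ns}. odd i} = Ns div 2"
      using card_odd_upto[of "Ns div 2"] \<open>even Ns\<close> by simp
  qed auto
  ultimately show ?thesis by blast
qed

end
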